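(* Let $\mathfrak g$ be a finite-dimensional real nilpotent Lie algebra. Suppose that $\mathfrak g$ has an open respectful decomposition $(H,V)$ with $\dim V=2$. Then the following conditions hold: (1) $[V,V]\neq 0$, (2) $V\cap[V,\mathfrak g]=0$, (3) $[V,\mathfrak g]\neq[\mathfrak g,\mathfrak g]$. Conversely, given a vector subspace $V\subseteq\mathfrak g$ of dimension $2$ that satisfies (1), (2) and (3), there exists a vector subspace $H\subseteq\mathfrak g$ such that $(H,V)$ is an open respectful decomposition of $\mathfrak g$.
   Context: All Lie algebras are real and finite dimensional. For vector subspaces $A,B$ of a Lie algebra, $[A,B]$ denotes the linear span of all brackets $[a,b]$, $a\in A$, $b\in B$. An ordered pair $(H,V)$ of complementary vector subspaces of a Lie algebra $\mathfrak g$ (so $\mathfrak g=H\oplus V$ as a vector space) is a respectful decomposition of $\mathfrak g$ if $[V,H]\subseteq H$. It is open if neither $H$ nor $V$ is a Lie subalgebra of $\mathfrak g$. *)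

theory Defs
  imports "HOL-Analysis.Analysis"
begin

text \<open>
  A Lie algebra is given by a bracket on a whole real vector space type, whose addition and
  scaling come from class \<open>real_vector\<close>; thus the algebra itself is \<open>UNIV\<close>. Finite
  dimensionality is required separately (\<open>finite_dim\<close>), since \<open>dim\<close> of an
  infinite-dimensional space is \<open>0\<close>.
\<close>

definition lie_algebra :: "('a::real_vector \<Rightarrow> 'a \<Rightarrow> 'a) \<Rightarrow> bool" where
  "lie_algebra br \<longleftrightarrow>
     bilinear br \<and>
     (\<forall>x. br x x = 0) \<and>
     (\<forall>x y z. br x (br y z) + br y (br z x) + br z (br x y) = 0)"

definition finite_dim :: "'a::real_vector itself \<Rightarrow> bool" where
  "finite_dim _ \<longleftrightarrow> (\<exists>B::'a set. finite B \<and> span B = UNIV)"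

definition lie_prod ::
  "('a::real_vector \<Rightarrow> 'a \<Rightarrow> 'a) \<Rightarrow> 'a set \<Rightarrow> 'a set \<Rightarrow> 'a set" where
  "lie_prod br A B = span {br a b |a b. a \<in> A \<and> b \<in> B}"

primrec lower_central ::
  "('a::real_vector \<Rightarrow> 'a \<Rightarrow> 'a) \<Rightarrow> nat \<Rightarrow> 'a set" where
  "lower_central br 0 = UNIV"
| "lower_central br (Suc n) = lie_prod br UNIV (lower_central br n)"

definition nilpotent_lie :: "('a::real_vector \<Rightarrow> 'a \<Rightarrow> 'a) \<Rightarrow> bool" where
  "nilpotent_lie br \<longleftrightarrow> (\<exists>n. lower_central br n = {0})"

definition lie_subalgebra ::
  "('a::real_vector \<Rightarrow> 'a \<Rightarrow> 'a) \<Rightarrow> 'a set \<Rightarrow> bool" where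
  "lie_subalgebra br A \<longleftrightarrow> subspace A \<and> (\<forall>x\<in>A. \<forall>y\<in>A. br x y \<in> A)"

definition complementary :: "'a::real_vector set \<Rightarrow> 'a set \<Rightarrow> bool" where
  "complementary H V \<longleftrightarrow>
     subspace H \<and> subspace V \<and> H \<inter> V = {0} \<and> {h + v |h v. h \<in> H \<and> v \<in> V} = UNIV"

definition respectful_decomposition ::
  "('a::real_vector \<Rightarrow> 'a \<Rightarrow> 'a) \<Rightarrow> 'a set \<Rightarrow> 'a set \<Rightarrow> bool" where
  "respectful_decomposition br H V \<longleftrightarrow> complementary H V \<and> lie_prod br V H \<subseteq> H"

definition open_respectful_decomposition ::
  "('a::real_vector \<Rightarrow> 'a \<Rightarrow> 'a) \<Rightarrow> 'a set \<Rightarrow> 'a set \<Rightarrow> bool" where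
  "open_respectful_decomposition br H V \<longleftrightarrow>
     respectful_decomposition br H V \<and> \<not> lie_subalgebra br H \<and> \<not> lie_subalgebra br V"

end

theory Submission
  imports Defs
begin

text \<open>
  Let \<open>(H, V)\<close> be a respectful decomposition with \<open>dim V = 2\<close> and \<open>V\<close> not a subalgebra, and let \<open>z\<close>
  span \<open>[V, V]\<close>. If the component \<open>v\<close> of \<open>z\<close> along \<open>V\<close> were nonzero, then some \<open>w \<in> V\<close> would satisfy
  \<open>[w, v] = k z\<close> with \<open>k \<noteq> 0\<close>; as \<open>ad w\<close> preserves \<open>H\<close>, it would have the nonzero eigenvalue \<open>k\<close>
  modulo \<open>H\<close>, contradicting nilpotency. Hence \<open>z \<in> H\<close>, so \<open>[V, UNIV] \<subseteq> H\<close>, which gives (2), and (3)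
  because \<open>H\<close> is not a subalgebra.

  Conversely put \<open>W = [V, UNIV]\<close>. Every complement \<open>H \<supseteq> W\<close> of \<open>V\<close> is respectful, so only \<open>[H, H] \<subseteq> H\<close>
  has to be avoided. Take a bracket \<open>u = [p, q] \<notin> W\<close>. Moving \<open>p\<close> and \<open>q\<close> along \<open>V\<close> into \<open>H\<close> changes \<open>u\<close>
  only by an element of \<open>W\<close>, so it suffices that \<open>u \<notin> H\<close>, and this holds once \<open>u - v \<in> H\<close> for some
  nonzero \<open>v \<in> V\<close>.
\<close>

section \<open>Spans of brackets and linear complements\<close>

lemma lie_prod_subset_iff:
  assumes "subspace S"
  shows "lie_prod br A B \<subseteq> S \<longleftrightarrow> (\<forall>a\<in>A. \<forall>b\<in>B. br a b \<in> S)"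
proof
  assume "lie_prod br A B \<subseteq> S"
  then show "\<forall>a\<in>A. \<forall>b\<in>B. br a b \<in> S"
    unfolding lie_prod_def by (blast intro: span_base)
next
  assume "\<forall>a\<in>A. \<forall>b\<in>B. br a b \<in> S"
  then have "{br a b |a b. a \<in> A \<and> b \<in> B} \<subseteq> S"
    by blast
  then show "lie_prod br A B \<subseteq> S"
    unfolding lie_prod_def by (rule span_minimal[OF _ assms])
qed

lemma subspace_lie_prod: "subspace (lie_prod br A B)"
  by (simp add: lie_prod_def)

lemma lie_prodI: "a \<in> A \<Longrightarrow> b \<in> B \<Longrightarrow> br a b \<in> lie_prod br A B"
  unfolding lie_prod_def by (blast intro: span_base)

lemma lie_prod_mono: "A \<subseteq> A' \<Longrightarrow> B \<subseteq> B' \<Longrightarrow> lie_prod br A B \<subseteq> lie_prod br A' B'"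
  unfolding lie_prod_def by (rule span_mono) blast

lemma lie_algebra_antisym:
  assumes "lie_algebra br"
  shows "br y x = - br x y"
proof -
  have b: "bilinear br" and z: "\<And>x. br x x = 0"
    using assms by (auto simp: lie_algebra_def)
  have "br y x + br x y = br (x + y) (x + y)"
    unfolding bilinear_ladd[OF b] bilinear_radd[OF b] by (simp add: z)
  also have "\<dots> = 0"
    by (rule z)
  finally show ?thesis
    by (simp only: eq_neg_iff_add_eq_0)
qed

lemma complementary_decompose:
  assumes "complementary H V"
  obtains h v where "h \<in> H" "v \<in> V" "x = h + v"
proof -
  have "x \<in> {h + v |h v. h \<in> H \<and> v \<in> V}"
    using assms by (simp add: complementary_def)
  then show thesis
    using that by blast
qed

text \<open>The complement is the kernel of a linear retraction onto \<open>V\<close> that kills \<open>A\<close>.\<close>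
lemma complementary_extend:
  fixes A V :: "'a::real_vector set"
  assumes A: "subspace A" and V: "subspace V" and AV: "A \<inter> V = {0}"
  obtains H where "A \<subseteq> H" "complementary H V"
proof -
  obtain p :: "'a \<Rightarrow> 'a" where p: "range p \<subseteq> A" "linear p" "\<And>a. a \<in> A \<Longrightarrow> p a = a"
    using linear_exists_left_inverse_on[OF linear_id A] by auto
  \<comment> \<open>Since \<open>p\<close> projects onto \<open>A\<close>, the kernel of
    \<open>q\<close> is exactly \<open>A\<close>, so \<open>A \<inter> V = {0}\<close> makes
    \<open>q\<close> injective on \<open>V\<close>.\<close>
  define q where "q x = x - p x" for x
  have q: "linear q"
    unfolding q_def using p(2) linear_compose_sub linear_ident by blast
  have "inj_on q V"
  proof (rule inj_onI)
    fix x y assume xy: "x \<in> V" "y \<in> V" "q x = q y"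
    then have "x - y = p (x - y)"
      by (simp add: q_def linear_diff[OF p(2)] algebra_simps)
    then have "x - y \<in> A"
      using p(1) by (metis rangeI subsetD)
    moreover have "x - y \<in> V"
      using xy V by (simp add: subspace_diff)
    ultimately have "x - y = 0"
      using AV by blast
    then show "x = y"
      by simp
  qed
  then obtain g :: "'a \<Rightarrow> 'a" where g: "range g \<subseteq> V" "linear g" "\<And>v. v \<in> V \<Longrightarrow> g (q v) = v"
    using linear_exists_left_inverse_on[OF q V] by auto
  define f where "f x = g (q x)" for x
  have f: "linear f"
    unfolding f_def using linear_compose[OF q g(2)] by (simp add: o_def)
  have fV: "f x \<in> V" for x
    using g(1) by (auto simp: f_def)
  have f_id: "f v = v" if "v \<in> V" for v
    using g(3) that by (simp add: f_def)
  show thesis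
  proof (rule that)
    show "A \<subseteq> {x. f x = 0}"
      by (auto simp: f_def q_def p(3) linear_0[OF g(2)])
    have "subspace {x. f x = 0}"
      by (rule linear_subspace_kernel[OF f])
    moreover have "{x. f x = 0} \<inter> V = {0}"
      using f_id linear_0[OF f] subspace_0[OF V] by auto
    moreover have "x \<in> {h + v |h v. h \<in> {x. f x = 0} \<and> v \<in> V}" for x
    proof -
      have "f (x - f x) = 0"
        by (simp add: linear_diff[OF f] f_id fV)
      then have "x = (x - f x) + f x \<and> x - f x \<in> {x. f x = 0} \<and> f x \<in> V"
        by (simp add: fV)
      then show ?thesis
        by blast
    qed
    ultimately show "complementary {x. f x = 0} V"
      using V by (auto simp: complementary_def)
  qed
qed

section \<open>Necessity of the three conditions\<close>

text \<open>Modulo \<open>H\<close>, \<open>v\<close> is an eigenvector of \<open>ad w\<close> for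
  the eigenvalue \<open>k\<close>. The \<open>n\<close>-th iterate of \<open>ad w\<close> maps
  \<open>v\<close> into the \<open>n\<close>-th term of the lower central series and acts on it as
  \<open>k ^ n\<close> modulo \<open>H\<close>; once that term is zero,
  \<open>k ^ n *\<^sub>R v\<close> lies in \<open>H\<close>.\<close>

lemma nilpotent_lie_eigenvector_mod:
  assumes "bilinear br" and "nilpotent_lie br" and H: "subspace H"
    and wH: "\<And>h. h \<in> H \<Longrightarrow> br w h \<in> H"
    and wv: "br w v - k *\<^sub>R v \<in> H" and k: "k \<noteq> 0"
  shows "v \<in> H"
proof -
  have "\<exists>x \<in> lower_central br n. x - k ^ n *\<^sub>R v \<in> H" for n
  proof (induction n)
    case 0
    then show ?case
      using subspace_0[OF H] by (intro bexI[of _ v]) auto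
  next
    case (Suc n)
    then obtain x where x: "x \<in> lower_central br n" "x - k ^ n *\<^sub>R v \<in> H"
      by blast
    have "br w x - k ^ Suc n *\<^sub>R v
        = br w (x - k ^ n *\<^sub>R v) + k ^ n *\<^sub>R (br w v - k *\<^sub>R v)"
      by (simp add: bilinear_rsub[OF assms(1)] bilinear_rmul[OF assms(1)] algebra_simps)
    also have "\<dots> \<in> H"
      using wH[OF x(2)] wv by (simp add: H subspace_add subspace_scale)
    finally show ?case
      using x(1) by (auto intro!: bexI[of _ "br w x"] lie_prodI)
  qed
  moreover obtain n where "lower_central br n = {0}"
    using assms(2) by (auto simp: nilpotent_lie_def)
  ultimately have "- (k ^ n *\<^sub>R v) \<in> H"
    by (metis diff_0 singletonD)
  then have "(- 1 / k ^ n) *\<^sub>R (- (k ^ n *\<^sub>R v)) \<in> H"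
    using H subspace_scale by blast
  then show ?thesis
    using k by simp
qed

text \<open>On a plane an alternating bilinear map is the determinant times one fixed vector, here
  \<open>z = br x y\<close> for a basis \<open>x\<close>, \<open>y\<close>, and the determinant is
  nondegenerate. The case \<open>z = 0\<close> is allowed.\<close>

lemma lie_bracket_two_dim:
  fixes V :: "'a::real_vector set"
  assumes br: "lie_algebra br" and V: "subspace V" "dim V = 2"
  obtains z where "\<And>a b. a \<in> V \<Longrightarrow> b \<in> V \<Longrightarrow> \<exists>c. br a b = c *\<^sub>R z"
    and "\<And>v. v \<in> V \<Longrightarrow> v \<noteq> 0 \<Longrightarrow> \<exists>w\<in>V. \<exists>k. k \<noteq> 0 \<and> br w v = k *\<^sub>R z"
proof -
  have b: "bilinear br" and bxx: "\<And>x. br x x = 0"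
    using br by (auto simp: lie_algebra_def)
  obtain B where B: "B \<subseteq> V" "V \<subseteq> span B" "card B = 2"
    using basis_exists[of V] V(2) by metis
  then obtain x y where xy: "B = {x, y}"
    by (auto simp: card_2_iff)
  have comb: "\<exists>s t. a = s *\<^sub>R x + t *\<^sub>R y" if "a \<in> V" for a
  proof -
    have "a \<in> span {x, y}"
      using that B(2) xy by blast
    then obtain s t where "a - s *\<^sub>R x = t *\<^sub>R y"
      by (auto simp: span_breakdown_eq)
    then have "a = s *\<^sub>R x + t *\<^sub>R y"
      by (simp add: algebra_simps)
    then show ?thesis
      by blast
  qed
  have yx: "br y x = - br x y"
    by (rule lie_algebra_antisym[OF br])
  have det: "br (s *\<^sub>R x + t *\<^sub>R y) (s' *\<^sub>R x + t' *\<^sub>R y) = (s * t' - t * s') *\<^sub>R br x y" for s t s' t'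
    by (simp add: bilinear_ladd[OF b] bilinear_radd[OF b] bilinear_lmul[OF b]
        bilinear_rmul[OF b] bxx yx algebra_simps)
  show thesis
  proof (rule that)
    fix a c assume "a \<in> V" "c \<in> V"
    then show "\<exists>k. br a c = k *\<^sub>R br x y"
      using comb det by metis
  next
    fix v assume v: "v \<in> V" "v \<noteq> 0"
    obtain s t where st: "v = s *\<^sub>R x + t *\<^sub>R y"
      using comb v(1) by blast
    \<comment> \<open>the rotated vector turns the determinant into a sum of squares\<close>
    have w: "t *\<^sub>R x + (- s) *\<^sub>R y \<in> V"
      using B(1) xy V(1) by (auto intro!: subspace_add subspace_scale subspace_diff)
    have "br (t *\<^sub>R x + (- s) *\<^sub>R y) v = (t * t + s * s) *\<^sub>R br x y"
      using det[of t "- s" s t] by (simp add: st)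
    moreover have "t * t + s * s \<noteq> 0"
      using v(2) st by (auto simp: sum_squares_eq_zero_iff)
    ultimately show "\<exists>w\<in>V. \<exists>k. k \<noteq> 0 \<and> br w v = k *\<^sub>R br x y"
      using w by blast
  qed
qed

lemma respectful_lie_prod_subset:
  fixes V :: "'a::real_vector set"
  assumes br: "lie_algebra br" and nil: "nilpotent_lie br"
    and HV: "respectful_decomposition br H V"
    and dimV: "dim V = 2"
  shows "lie_prod br V UNIV \<subseteq> H"
proof -
  have b: "bilinear br"
    using br by (auto simp: lie_algebra_def)
  have comp: "complementary H V" and H: "subspace H" and V: "subspace V"
    and disj: "H \<inter> V = {0}"
    using HV by (auto simp: respectful_decomposition_def complementary_def)
  have VH: "br v h \<in> H" if "v \<in> V" "h \<in> H" for v h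
    using HV that lie_prod_subset_iff[OF H] by (auto simp: respectful_decomposition_def)
  obtain z where z1: "\<And>a c. a \<in> V \<Longrightarrow> c \<in> V \<Longrightarrow> \<exists>k. br a c = k *\<^sub>R z"
    and z2: "\<And>v. v \<in> V \<Longrightarrow> v \<noteq> 0 \<Longrightarrow> \<exists>w\<in>V. \<exists>k. k \<noteq> 0 \<and> br w v = k *\<^sub>R z"
    using lie_bracket_two_dim[OF br V dimV] by metis
  obtain h v where hv: "h \<in> H" "v \<in> V" "z = h + v"
    using complementary_decompose[OF comp] .
  have "v = 0"
  proof (rule ccontr)
    assume v: "v \<noteq> 0"
    then obtain w k where w: "w \<in> V" "k \<noteq> 0" "br w v = k *\<^sub>R z"
      using z2 hv(2) by blast
    \<comment> \<open>As \<open>z\<close> and \<open>v\<close> agree modulo \<open>H\<close>,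
      \<open>v\<close> is an eigenvector of \<open>ad w\<close> there.\<close>
    have "br w v - k *\<^sub>R v = k *\<^sub>R h"
      by (simp add: w(3) hv(3) algebra_simps)
    then have "br w v - k *\<^sub>R v \<in> H"
      using hv(1) H by (simp add: subspace_scale)
    then have "v \<in> H"
      using nilpotent_lie_eigenvector_mod[OF b nil H] VH[OF w(1)] w(2) by blast
    then show False
      using v hv(2) disj by blast
  qed
  then have zH: "z \<in> H"
    using hv by simp
  have "br a g \<in> H" if a: "a \<in> V" for a g
  proof -
    obtain h v where g: "h \<in> H" "v \<in> V" "g = h + v"
      using complementary_decompose[OF comp] .
    obtain c where "br a v = c *\<^sub>R z"
      using z1 a g(2) by blast
    then show ?thesis
      using VH[OF a g(1)] zH H by (simp add: g(3) bilinear_radd[OF b] subspace_add subspace_scale)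
  qed
  then show ?thesis
    using lie_prod_subset_iff[OF H] by blast
qed

lemma open_respectful_decomposition_imp:
  fixes V :: "'a::real_vector set"
  assumes br: "lie_algebra br" and nil: "nilpotent_lie br"
    and HV: "open_respectful_decomposition br H V"
    and dimV: "dim V = 2"
  shows "lie_prod br V V \<noteq> {0}"
    and "V \<inter> lie_prod br V UNIV = {0}"
    and "lie_prod br V UNIV \<noteq> lie_prod br UNIV UNIV"
proof -
  have resp: "respectful_decomposition br H V"
    and nH: "\<not> lie_subalgebra br H" and nV: "\<not> lie_subalgebra br V"
    using HV by (auto simp: open_respectful_decomposition_def)
  have H: "subspace H" and V: "subspace V" and disj: "H \<inter> V = {0}"
    using resp by (auto simp: respectful_decomposition_def complementary_def)
  have VgH: "lie_prod br V UNIV \<subseteq> H"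
    by (rule respectful_lie_prod_subset[OF br nil resp dimV])
  show "lie_prod br V V \<noteq> {0}"
    using nV V subspace_0[OF V] lie_prodI[of _ V _ V br] by (auto simp: lie_subalgebra_def)
  show "V \<inter> lie_prod br V UNIV = {0}"
    using VgH disj subspace_0[OF V] subspace_0[OF subspace_lie_prod] by blast
  \<comment> \<open>Equality would put every bracket into \<open>[V, UNIV] \<subseteq> H\<close>,
    making \<open>H\<close> a subalgebra.\<close>
  show "lie_prod br V UNIV \<noteq> lie_prod br UNIV UNIV"
    using nH H VgH lie_prodI[of _ UNIV _ UNIV br] by (auto simp: lie_subalgebra_def)
qed

section \<open>Construction of \<open>H\<close> from the three conditions\<close>

text \<open>Adjoining \<open>u - v\<close> to \<open>W\<close> keeps \<open>u\<close> out of
  \<open>H\<close>: otherwise the nonzero \<open>v\<close> would lie in \<open>H \<inter> V\<close>.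
  The choice of \<open>v\<close> must leave the enlarged space disjoint from \<open>V\<close> apart
  from zero.\<close>

lemma exists_complementary_avoiding:
  fixes W V :: "'a::real_vector set"
  assumes W: "subspace W" and V: "subspace V" and WV: "W \<inter> V = {0}"
    and V0: "V \<noteq> {0}" and u: "u \<notin> W"
  obtains H where "W \<subseteq> H" "complementary H V" "u \<notin> H"
proof -
  \<comment> \<open>If \<open>u\<close> lies in \<open>W + V\<close>, then \<open>v\<close> is its
    component along \<open>V\<close>, nonzero because \<open>u \<notin> W\<close>, and
    \<open>u - v\<close> adds nothing to \<open>W\<close>. Otherwise any nonzero \<open>v\<close>
    serves.\<close>
  obtain v where v: "v \<in> V" "v \<noteq> 0" "u - v \<in> W \<or> (\<forall>x\<in>V. u - x \<notin> W)"
  proof (cases "\<exists>x\<in>V. u - x \<in> W")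
    case True
    then show ?thesis
      using that u by force
  next
    case False
    then show ?thesis
      using that V0 subspace_0[OF V] by blast
  qed
  define A where "A = span (insert (u - v) W)"
  have "x = 0" if x: "x \<in> A" "x \<in> V" for x
  proof -
    have spanW: "span W = W"
      using W by (simp add: span_eq_iff)
    obtain c where c: "x - c *\<^sub>R (u - v) \<in> W"
      using x(1) by (auto simp: A_def span_breakdown_eq spanW)
    have "x \<in> W"
    proof (cases "u - v \<in> W \<or> c = 0")
      case True
      then have "c *\<^sub>R (u - v) \<in> W"
        using W by (auto simp: subspace_scale subspace_0)
      then show ?thesis
        using subspace_add[OF W c] by (metis diff_add_cancel)
    next
      case False
      \<comment> \<open>Dividing by \<open>c\<close> exhibits \<open>u\<close> as an element of
        \<open>W + V\<close>, which the choice of \<open>v\<close> excludes when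
        \<open>u - v \<notin> W\<close>.\<close>
      then have "u - (v + (1 / c) *\<^sub>R x) = (- 1 / c) *\<^sub>R (x - c *\<^sub>R (u - v))"
        by (simp add: algebra_simps)
      then have "u - (v + (1 / c) *\<^sub>R x) \<in> W"
        using subspace_scale[OF W c] by metis
      moreover have "v + (1 / c) *\<^sub>R x \<in> V"
        using v(1) x(2) V by (simp add: subspace_add subspace_scale)
      ultimately show ?thesis
        using v(3) False by blast
    qed
    then show ?thesis
      using x(2) WV by blast
  qed
  then have AV: "A \<inter> V = {0}"
    using subspace_0[OF V] span_0 by (auto simp: A_def)
  have "subspace A"
    by (simp add: A_def)
  then obtain H where H: "A \<subseteq> H" "complementary H V"
    using complementary_extend[OF _ V AV] by blast
  have sH: "subspace H" and HV: "H \<inter> V = {0}"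
    using H(2) by (auto simp: complementary_def)
  have "insert (u - v) W \<subseteq> H"
    using H(1) span_superset unfolding A_def by blast
  moreover have "u \<notin> H"
  proof
    assume "u \<in> H"
    then have "u - (u - v) \<in> H"
      using \<open>insert (u - v) W \<subseteq> H\<close> sH subspace_diff by blast
    then show False
      using v(1,2) HV by auto
  qed
  ultimately show thesis
    using that H(2) by blast
qed

lemma exists_open_respectful_decomposition:
  fixes V :: "'a::real_vector set"
  assumes br: "lie_algebra br" and V: "subspace V"
    and c1: "lie_prod br V V \<noteq> {0}"
    and c2: "V \<inter> lie_prod br V UNIV = {0}"
    and c3: "lie_prod br V UNIV \<noteq> lie_prod br UNIV UNIV"
  obtains H where "open_respectful_decomposition br H V"
proof -
  define W where "W = lie_prod br V UNIV"
  have b: "bilinear br"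
    using br by (auto simp: lie_algebra_def)
  have W: "subspace W"
    by (simp add: W_def subspace_lie_prod)
  have VW: "br a x \<in> W" if "a \<in> V" for a x
    using that by (auto simp: W_def intro: lie_prodI)
  have WV': "br x a \<in> W" if "a \<in> V" for a x
    using subspace_neg[OF W VW[OF that, of x]] lie_algebra_antisym[OF br, of x a] by simp
  have "\<not> lie_prod br UNIV UNIV \<subseteq> W"
    using c3 lie_prod_mono[of V UNIV UNIV UNIV br] by (auto simp: W_def)
  then obtain p q where pq: "br p q \<notin> W"
    using lie_prod_subset_iff[OF W] by blast
  have V0: "V \<noteq> {0}"
  proof
    assume "V = {0}"
    then have "lie_prod br V V = {0}"
      by (simp add: lie_prod_def bilinear_lzero[OF b])
    then show False
      using c1 by simp
  qed
  obtain H where H: "W \<subseteq> H" "complementary H V" "br p q \<notin> H"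
    using exists_complementary_avoiding[OF W V _ V0 pq] c2 W_def by blast
  have sH: "subspace H"
    using H(2) by (simp add: complementary_def)
  have "lie_prod br V H \<subseteq> H"
    using VW H(1) by (auto simp: lie_prod_subset_iff[OF sH])
  moreover have "\<not> lie_subalgebra br V"
  proof
    assume "lie_subalgebra br V"
    then have "lie_prod br V V \<subseteq> V"
      by (auto simp: lie_subalgebra_def lie_prod_subset_iff)
    moreover have "lie_prod br V V \<subseteq> lie_prod br V UNIV"
      by (rule lie_prod_mono) auto
    ultimately have "lie_prod br V V \<subseteq> {0}"
      using c2 by blast
    then show False
      using c1 subspace_0[OF subspace_lie_prod[of br V V]] by blast
  qed
  moreover have "\<not> lie_subalgebra br H"
  proof
    assume sub: "lie_subalgebra br H"
    obtain p' a where p: "p' \<in> H" "a \<in> V" "p = p' + a"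
      using complementary_decompose[OF H(2)] .
    obtain q' c where q: "q' \<in> H" "c \<in> V" "q = q' + c"
      using complementary_decompose[OF H(2)] .
    \<comment> \<open>Only \<open>p'\<close> is bracketed with the split \<open>q\<close>, so each
      of the two correction terms has a factor in \<open>V\<close> and hence lies in
      \<open>W\<close>.\<close>
    have "br p q = br p' q' + (br p' c + br a q)"
      by (simp add: p(3) q(3) bilinear_ladd[OF b] bilinear_radd[OF b])
    moreover have "br p' q' \<in> H"
      using sub p(1) q(1) by (auto simp: lie_subalgebra_def)
    moreover have "br p' c + br a q \<in> H"
      using WV'[OF q(2)] VW[OF p(2)] H(1) sH by (blast intro: subspace_add)
    ultimately show False
      using H(3) subspace_add[OF sH] by simp
  qed
  ultimately show thesis
    using that H(2) by (simp add: open_respectful_decomposition_def respectful_decomposition_def)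
qed

theorem theorem1:
  fixes br :: "'a::real_vector \<Rightarrow> 'a \<Rightarrow> 'a"
  assumes "finite_dim TYPE('a)"
    and "lie_algebra br"
    and "nilpotent_lie br"
  shows "(\<forall>H V. open_respectful_decomposition br H V \<and> dim V = 2 \<longrightarrow>
            lie_prod br V V \<noteq> {0} \<and>
            V \<inter> lie_prod br V UNIV = {0} \<and>
            lie_prod br V UNIV \<noteq> lie_prod br UNIV UNIV)
       \<and> (\<forall>V. subspace V \<and> dim V = 2 \<and>
            lie_prod br V V \<noteq> {0} \<and>
            V \<inter> lie_prod br V UNIV = {0} \<and>
            lie_prod br V UNIV \<noteq> lie_prod br UNIV UNIV \<longrightarrow>
            (\<exists>H. open_respectful_decomposition br H V))"
proof (intro conjI allI impI; elim conjE)
  fix H V :: "'a set"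
  assume "open_respectful_decomposition br H V" "dim V = 2"
  note imp = open_respectful_decomposition_imp[OF assms(2,3) this]
  show "lie_prod br V V \<noteq> {0}" "V \<inter> lie_prod br V UNIV = {0}"
    "lie_prod br V UNIV \<noteq> lie_prod br UNIV UNIV"
    by (fact imp)+
next
  fix V :: "'a set"
  assume "subspace V" "lie_prod br V V \<noteq> {0}" "V \<inter> lie_prod br V UNIV = {0}"
    "lie_prod br V UNIV \<noteq> lie_prod br UNIV UNIV"
  then show "\<exists>H. open_respectful_decomposition br H V"
    using exists_open_respectful_decomposition[OF assms(2)] by metis
qed

end
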